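(* Let $\eta\colon M_n(\mathbb C)\to M_n(\mathbb C)$ be a self-adjoint completely positive map, $\eta(X)=\sum_{i=1}^rA_iXA_i$ with $A_i^*=A_i$. Define $F(X)=(\eta(X))^{-1}$ for $X\in\mathcal P_n$. If $(C,D)$ is a 2-cycle of $F$ in $\mathcal P_n$, i.e. $F(C)=D$ and $F(D)=C$ with $C\ne D$, then $F$ reverses the geodesic $\gamma_{C\to D}$, acting as reflection about its midpoint $C\mathbin{\#}D$: $$F(\gamma_{C\to D}(t))=\gamma_{C\to D}(1-t)\qquad\text{for all }t\in\mathbb R.$$
   Context: $\mathcal P_n$ is the set of positive definite matrices in $M_n(\mathbb C)$. For $C,D\in\mathcal P_n$, $\gamma_{C\to D}(t)=C^{1/2}\left(C^{-1/2}DC^{-1/2}\right)^tC^{1/2}$, $t\in\mathbb R$ (the geodesic through $C$ and $D$ for the Riemannian metric $g_C(H,K)=\mathrm{Tr}(C^{-1}HC^{-1}K)$ on $\mathcal P_n$), and $C\mathbin{\#}D=\gamma_{C\to D}(1/2)$ is the geometric mean. *)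

theory Defs
  imports "HOL-Analysis.Analysis"
begin

definition ctranspose :: "complex ^ 'n ^ 'm \<Rightarrow> complex ^ 'm ^ 'n" where
  "ctranspose A = transpose (map_matrix cnj A)"

definition hermitian :: "complex ^ 'n ^ 'n \<Rightarrow> bool" where
  "hermitian A \<longleftrightarrow> ctranspose A = A"

definition unitary :: "complex ^ 'n ^ 'n \<Rightarrow> bool" where
  "unitary U \<longleftrightarrow> U ** ctranspose U = mat 1 \<and> ctranspose U ** U = mat 1"

text \<open>The set of positive definite matrices. For Hermitian \<open>A\<close> the form \<open>x* A x\<close> is real-valued,
  so taking its real part loses nothing.\<close>

definition posdef :: "(complex ^ 'n ^ 'n) set" where
  "posdef = {A. hermitian A \<and>
     (\<forall>x. x \<noteq> 0 \<longrightarrow> 0 < Re (\<Sum>i\<in>UNIV. cnj (x $ i) * (A *v x) $ i))}"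

definition real_diag :: "('n \<Rightarrow> real) \<Rightarrow> complex ^ 'n ^ 'n" where
  "real_diag d = (\<chi> i j. if i = j then of_real (d i) else 0)"

text \<open>Real powers of a positive definite matrix by the spectral calculus:
  \<open>A = U diag(d) U*\<close> gives \<open>A\<^sup>t = U diag(d\<^sup>t) U*\<close>, which does not depend on the chosen
  diagonalisation. The value is unspecified outside \<^term>\<open>posdef\<close>.\<close>

definition mat_powr :: "complex ^ 'n ^ 'n \<Rightarrow> real \<Rightarrow> complex ^ 'n ^ 'n" where
  "mat_powr A t = (THE B. \<exists>U d. unitary U \<and> (\<forall>i. 0 < d i) \<and>
     A = U ** real_diag d ** ctranspose U \<and>
     B = U ** real_diag (\<lambda>i. d i powr t) ** ctranspose U)"

definition geodesic :: "complex ^ 'n ^ 'n \<Rightarrow> complex ^ 'n ^ 'n \<Rightarrow> real \<Rightarrow> complex ^ 'n ^ 'n" where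
  "geodesic C D t =
     mat_powr C (1/2)
       ** mat_powr (mat_powr C (- (1/2)) ** D ** mat_powr C (- (1/2))) t
       ** mat_powr C (1/2)"

text \<open>The map \<open>X \<mapsto> \<eta>(X)\<^sup>-\<^sup>1\<close> on \<^term>\<open>posdef\<close>. It is a partial function because \<^const>\<open>matrix_inv\<close>
  is total: an equation \<open>inverse_map \<eta> X = Some Y\<close> says that \<open>X\<close> is positive definite,
  \<open>\<eta> X\<close> is invertible, and its inverse is \<open>Y\<close>.\<close>

definition inverse_map ::
  "(complex ^ 'n ^ 'n \<Rightarrow> complex ^ 'n ^ 'n) \<Rightarrow> complex ^ 'n ^ 'n \<Rightarrow> (complex ^ 'n ^ 'n) option"
  where
  "inverse_map \<eta> X =
     (if X \<in> posdef \<and> invertible (\<eta> X) then Some (matrix_inv (\<eta> X)) else None)"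

definition two_cycle :: "('a \<Rightarrow> 'a option) \<Rightarrow> 'a \<Rightarrow> 'a \<Rightarrow> bool" where
  "two_cycle f x y \<longleftrightarrow> f x = Some y \<and> f y = Some x \<and> x \<noteq> y"

end

theory Submission
  imports Defs
begin

text \<open>Write \<open>C = W W\<^sup>*\<close> and \<open>D = W diag(m) W\<^sup>*\<close> with \<open>W\<close> invertible and \<open>m > 0\<close>. In the coordinates
  given by \<open>W\<close> the geodesic is \<open>t \<mapsto> diag(m\<^sup>t)\<close>, and \<open>\<eta>\<close> becomes \<open>X \<mapsto> \<Sum>\<^sub>i B\<^sub>i X B\<^sub>i\<close> with the Hermitian
  matrices \<open>B\<^sub>i = W\<^sup>* A\<^sub>i W\<close>. The two-cycle equations turn into
  \<open>\<Sum>\<^sub>i B\<^sub>i B\<^sub>i = diag(m)\<^sup>-\<^sup>1\<close> and \<open>\<Sum>\<^sub>i B\<^sub>i diag(m) B\<^sub>i = 1\<close>.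

  Their diagonal entries force each \<open>B\<^sub>i\<close> to commute with \<open>diag(m)\<close>. With the symmetric weights
  \<open>p j k\<close> that add up the squared moduli of the \<open>(j, k)\<close> entries of all \<open>B\<^sub>i\<close>, they read \<open>(\<Sum>\<^sub>k p j k) m j = 1 = \<Sum>\<^sub>k p j k m k\<close>: the
  function \<open>m\<close> is harmonic on a finite weighted graph. A harmonic function on such a graph is
  constant along edges (\<open>harmonic_imp_locally_constant\<close>), so every \<open>B\<^sub>i\<close> has non-zero entries only
  where \<open>m j = m k\<close> and commutes with \<open>diag(m)\<close> (\<open>two_cycle_imp_commute\<close>), hence with each
  \<open>diag(m\<^sup>t)\<close>. Therefore \<open>\<Sum>\<^sub>i B\<^sub>i diag(m\<^sup>t) B\<^sub>i = diag(m\<^sup>t) diag(m)\<^sup>-\<^sup>1\<close>, whose inverse is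
  \<open>diag(m\<^sup>1\<^sup>-\<^sup>t)\<close>; back in the original coordinates this is the claim.

  The coordinates \<open>W\<close> come from two applications of the spectral theorem, which is proved here by
  splitting off one eigenvector at a time (\<open>hermitian_eigenvector_in_complement\<close>). The
  powers in the geodesic can be computed from any diagonalisation (\<open>mat_powr_spectral\<close>).\<close>

section \<open>Conjugate transposes and Hermitian matrices\<close>

lemma ctranspose_nth [simp]: "ctranspose A $ i $ j = cnj (A $ j $ i)"
  by (simp add: ctranspose_def transpose_def)

lemma ctranspose_ctranspose [simp]: "ctranspose (ctranspose A) = A"
  by (simp add: vec_eq_iff)

lemma ctranspose_mult: "ctranspose (A ** B) = ctranspose B ** ctranspose A"
  by (simp add: vec_eq_iff matrix_matrix_mult_def mult.commute)

lemma ctranspose_mat_1 [simp]: "ctranspose (mat 1) = mat 1"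
  by (simp add: vec_eq_iff mat_def)

lemma hermitian_nth: "hermitian A \<Longrightarrow> cnj (A $ j $ i) = A $ i $ j"
  by (metis ctranspose_nth hermitian_def)

lemma hermitian_congruence: "hermitian A \<Longrightarrow> hermitian (ctranspose W ** A ** W)"
  by (simp add: hermitian_def ctranspose_mult matrix_mul_assoc)

lemma sum_matrix_mult_left:
  fixes f :: "'i \<Rightarrow> complex^'n^'n"
  shows "B ** (\<Sum>i\<in>I. f i) = (\<Sum>i\<in>I. B ** f i)"
proof -
  have "(B ** (\<Sum>i\<in>I. f i)) $ a $ b = (\<Sum>i\<in>I. B ** f i) $ a $ b" for a b
    unfolding matrix_matrix_mult_def by (simp add: sum_distrib_left) (rule sum.swap)
  then show ?thesis by (simp add: vec_eq_iff)
qed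

lemma sum_matrix_mult_right:
  fixes f :: "'i \<Rightarrow> complex^'n^'n"
  shows "(\<Sum>i\<in>I. f i) ** B = (\<Sum>i\<in>I. f i ** B)"
proof -
  have "((\<Sum>i\<in>I. f i) ** B) $ a $ b = (\<Sum>i\<in>I. f i ** B) $ a $ b" for a b
    unfolding matrix_matrix_mult_def by (simp add: sum_distrib_right) (rule sum.swap)
  then show ?thesis by (simp add: vec_eq_iff)
qed

lemma matrix_inv_eqI:
  fixes A B :: "complex^'n^'n"
  assumes "A ** B = mat 1"
  shows "matrix_inv A = B"
proof -
  have "B ** A = mat 1" using assms by (simp add: matrix_left_right_inverse)
  have "A ** matrix_inv A = mat 1 \<and> matrix_inv A ** A = mat 1"
    unfolding matrix_inv_def by (rule someI[of _ B]) (use assms \<open>B ** A = mat 1\<close> in auto)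
  then show ?thesis by (metis \<open>B ** A = mat 1\<close> matrix_mul_assoc matrix_mul_lid matrix_mul_rid)
qed

lemma matrix_mul_cancel_left: "A ** B = mat 1 \<Longrightarrow> A ** (B ** X) = (X :: complex^'n^'n)"
  by (simp add: matrix_mul_assoc)

text \<open>The real part of this Hermitian product is the Euclidean inner product of \<^typ>\<open>complex^'n\<close>
  as a real vector space (\<open>Re_cdot\<close>), so quadratic forms and compactness arguments can use the
  latter while orthogonality over the complex numbers uses the former.\<close>

definition cdot :: "complex^'n \<Rightarrow> complex^'n \<Rightarrow> complex" where
  "cdot x y = (\<Sum>i\<in>UNIV. cnj (x $ i) * y $ i)"

lemma cdot_adjoint: "cdot x (A *v y) = cdot (ctranspose A *v x) y"
  unfolding cdot_def matrix_vector_mult_def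
  by (simp add: sum_distrib_left sum_distrib_right, subst sum.swap) (simp add: algebra_simps)

lemma Re_cdot: "Re (cdot x y) = x \<bullet> y"
  by (simp add: cdot_def inner_vec_def inner_complex_def)

lemma cdot_self: "cdot x x = of_real (x \<bullet> x)"
proof (rule complex_eqI)
  show "Re (cdot x x) = Re (of_real (x \<bullet> x))" by (simp add: Re_cdot)
  show "Im (cdot x x) = Im (of_real (x \<bullet> x))" by (simp add: cdot_def)
qed

lemma cdot_commute: "cdot y x = cnj (cdot x y)"
  by (simp add: cdot_def mult.commute)

lemma cdot_add_right: "cdot x (y + z) = cdot x y + cdot x z"
  by (simp add: cdot_def algebra_simps sum.distrib)

lemma cdot_diff_right: "cdot x (y - z) = cdot x y - cdot x z"
  by (simp add: cdot_def algebra_simps sum_subtractf)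

lemma cdot_scaleR_right: "cdot x (c *\<^sub>R y) = of_real c * cdot x y"
  by (simp add: cdot_def sum_distrib_left scaleR_conv_of_real[where 'a=complex] algebra_simps)

lemma cdot_scaleR_left: "cdot (c *\<^sub>R x) y = of_real c * cdot x y"
  by (simp add: cdot_def sum_distrib_left scaleR_conv_of_real[where 'a=complex] algebra_simps)

lemma hermitian_inner: "hermitian A \<Longrightarrow> (A *v x) \<bullet> y = x \<bullet> (A *v y)"
  by (metis Re_cdot cdot_adjoint hermitian_def)

lemma matrix_vector_scaleR: "(A :: complex^'n^'m) *v (c *\<^sub>R x) = c *\<^sub>R (A *v x)"
  by (simp add: vec_eq_iff matrix_vector_mult_def scaleR_sum_right)

lemma posdef_iff: "A \<in> posdef \<longleftrightarrow> hermitian A \<and> (\<forall>x. x \<noteq> 0 \<longrightarrow> 0 < x \<bullet> (A *v x))"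
  by (simp add: posdef_def flip: cdot_def Re_cdot)

text \<open>Congruence by an invertible matrix is a change of variables in the quadratic form.\<close>

lemma posdef_congruence:
  fixes A W :: "complex^'n^'n"
  assumes "A \<in> posdef" and "V ** W = mat 1"
  shows "ctranspose W ** A ** W \<in> posdef"
proof -
  have "0 < x \<bullet> ((ctranspose W ** A ** W) *v x)" if "x \<noteq> 0" for x
  proof -
    have "V *v (W *v x) = x" by (simp add: matrix_vector_mul_assoc assms)
    then have "W *v x \<noteq> 0" using that by fastforce
    then have "0 < (W *v x) \<bullet> (A *v (W *v x))" using assms by (auto simp: posdef_iff)
    also have "\<dots> = x \<bullet> (ctranspose W *v (A *v (W *v x)))"
      by (metis Re_cdot cdot_adjoint ctranspose_ctranspose)
    finally show ?thesis by (simp add: matrix_vector_mul_assoc matrix_mul_assoc)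
  qed
  then show ?thesis using assms by (auto simp: posdef_iff hermitian_congruence)
qed

section \<open>The spectral theorem\<close>

text \<open>A Hermitian matrix preserves the orthogonal complement of any set \<open>u ` S\<close> of its
  eigenvectors, and the next eigenvector is found there: a maximiser \<open>v\<close> of the Rayleigh quotient over the unit sphere of that
  complement. Indeed the residual \<open>h = A v - \<lambda> v\<close> is again in the complement, and moving from
  \<open>v\<close> in the direction \<open>h\<close> would raise the quotient to first order unless \<open>h = 0\<close>.\<close>

lemma hermitian_eigenvector_in_complement:
  fixes A :: "complex^'n^'n" and u :: "'n \<Rightarrow> complex^'n"
  assumes "hermitian A" and "S \<noteq> UNIV"
    and eig: "\<And>j. j \<in> S \<Longrightarrow> A *v u j = d j *\<^sub>R u j"
  obtains v l where "v \<bullet> v = 1" "A *v v = l *\<^sub>R v" "\<And>j. j \<in> S \<Longrightarrow> cdot (u j) v = 0"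
proof -
  define V where "V = {x. \<forall>j\<in>S. cdot (u j) x = 0}"
  have V_add: "x + y \<in> V" if "x \<in> V" "y \<in> V" for x y using that by (simp add: V_def cdot_add_right)
  have V_diff: "x - y \<in> V" if "x \<in> V" "y \<in> V" for x y using that by (simp add: V_def cdot_diff_right)
  have V_scale: "c *\<^sub>R x \<in> V" if "x \<in> V" for c x using that by (simp add: V_def cdot_scaleR_right)
  have V_A: "A *v x \<in> V" if "x \<in> V" for x
    using that assms(1) by (simp add: V_def cdot_adjoint hermitian_def eig cdot_scaleR_left)
  have "closed V"
  proof -
    have "V = (\<Inter>j\<in>S. {x. cdot (u j) x = 0})" by (auto simp: V_def)
    then show ?thesis unfolding cdot_def
      by (auto intro!: closed_INT closed_Collect_eq continuous_intros)
  qed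
  \<comment> \<open>The vectors of \<open>u ` S\<close> fill the rows of a square matrix with at least one zero row; a
    vector in its kernel shows that the complement is not trivial.\<close>
  obtain x0 where x0: "x0 \<noteq> 0" "x0 \<in> V"
  proof -
    define M :: "complex^'n^'n" where "M = (\<chi> i j. if i \<in> S then cnj (u i $ j) else 0)"
    obtain k where "k \<notin> S" using assms(2) by auto
    then have "row k M = 0" by (simp add: M_def row_def vec_eq_iff)
    then have "det M = 0" by (rule det_zero_row)
    then have "\<not> (\<exists>B. B ** M = mat 1)" by (metis invertible_det_nz invertible_left_inverse)
    then obtain x where "M *v x = 0" "x \<noteq> 0" by (auto simp: matrix_left_invertible_ker)
    moreover have "cdot (u j) x = (M *v x) $ j" if "j \<in> S" for j
      using that by (simp add: cdot_def M_def matrix_vector_mult_def)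
    ultimately show ?thesis using that by (auto simp: V_def)
  qed
  have "compact (V \<inter> sphere 0 1)" using \<open>closed V\<close> by (simp add: closed_Int_compact)
  moreover have "(1 / norm x0) *\<^sub>R x0 \<in> V \<inter> sphere 0 1" using x0 V_scale by simp
  moreover have "continuous_on (V \<inter> sphere 0 1) (\<lambda>x. x \<bullet> (A *v x))"
    by (intro continuous_intros linear_continuous_on linear_conv_bounded_linear[THEN iffD1] linearI)
      (simp_all add: matrix_vector_right_distrib matrix_vector_scaleR)
  ultimately obtain v where v: "v \<in> V" "norm v = 1"
    and max: "\<And>y. y \<in> V \<Longrightarrow> norm y = 1 \<Longrightarrow> y \<bullet> (A *v y) \<le> v \<bullet> (A *v v)"
    using continuous_attains_sup[of "V \<inter> sphere 0 1" "\<lambda>x. x \<bullet> (A *v x)"] by fastforce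
  define l where "l = v \<bullet> (A *v v)"
  have vv: "v \<bullet> v = 1" using v by (simp add: dot_square_norm)
  have le: "w \<bullet> (A *v w) \<le> l * (w \<bullet> w)" if "w \<in> V" for w
  proof (cases "w = 0")
    case False
    have "((1 / norm w) *\<^sub>R w) \<bullet> (A *v ((1 / norm w) *\<^sub>R w)) \<le> l"
      unfolding l_def using that False V_scale by (intro max) auto
    then have "(w \<bullet> (A *v w)) / (norm w)\<^sup>2 \<le> l"
      by (simp add: matrix_vector_scaleR power2_eq_square)
    then show ?thesis using False by (simp add: dot_square_norm field_simps)
  qed simp
  \<comment> \<open>The residual \<open>h\<close> is orthogonal to \<open>v\<close>; \<open>b\<close> is the coefficient of \<open>s\<^sup>2\<close> in the
    inequality \<open>le\<close> at \<open>v + s h\<close>, whose linear term is \<open>2 s (h \<bullet> h)\<close>.\<close>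
  define h where "h = A *v v - l *\<^sub>R v"
  have hV: "h \<in> V" unfolding h_def using v by (intro V_diff V_A V_scale)
  have Av: "A *v v = h + l *\<^sub>R v" by (simp add: h_def)
  have hv: "h \<bullet> v = 0"
    unfolding inner_commute[of h v] using vv by (simp add: h_def inner_diff_right l_def)
  define b where "b = l * (h \<bullet> h) - h \<bullet> (A *v h)"
  have quad: "2 * s * (h \<bullet> h) \<le> s\<^sup>2 * b" for s
  proof -
    have vAh: "v \<bullet> (A *v h) = h \<bullet> h"
      unfolding hermitian_inner[OF assms(1), symmetric] Av inner_add_left inner_scaleR_left
      using hv by (simp add: inner_commute[of v h])
    have hAv: "h \<bullet> (A *v v) = h \<bullet> h"
      unfolding Av inner_add_right inner_scaleR_right hv by simp
    have "(v + s *\<^sub>R h) \<bullet> (A *v (v + s *\<^sub>R h)) = l + 2 * s * (h \<bullet> h) + s\<^sup>2 * (h \<bullet> (A *v h))"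
      using vAh hAv by (simp add: matrix_vector_right_distrib matrix_vector_scaleR
          inner_add_left inner_add_right power2_eq_square algebra_simps l_def)
    moreover have "(v + s *\<^sub>R h) \<bullet> (v + s *\<^sub>R h) = 1 + s\<^sup>2 * (h \<bullet> h)"
      using hv vv by (simp add: inner_add_left inner_add_right power2_eq_square inner_commute)
    ultimately show ?thesis
      using le[OF V_add[OF v(1) V_scale[OF hV, of s]]] by (simp add: b_def algebra_simps)
  qed
  have "h \<bullet> h = 0"
  proof (cases "b \<le> 0")
    case True
    moreover have "2 * (h \<bullet> h) \<le> b" using quad[of 1] by simp
    ultimately show ?thesis using inner_ge_zero[of h] by linarith
  next
    case False
    then have "2 * (h \<bullet> h)\<^sup>2 \<le> (h \<bullet> h)\<^sup>2"
      using quad[of "(h \<bullet> h) / b"] by (simp add: field_simps power2_eq_square)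
    then show ?thesis by simp
  qed
  then have "A *v v = l *\<^sub>R v" by (simp add: Av)
  then show ?thesis using that vv v by (auto simp: V_def)
qed

text \<open>Prescribing the index set \<open>S\<close> allows an induction that adds one eigenvector per step and needs
  no dimension count; for \<open>S = UNIV\<close> the vectors are the columns of a unitary matrix.\<close>

lemma hermitian_orthonormal_eigenvectors:
  fixes A :: "complex^'n^'n" and S :: "'n set"
  assumes "hermitian A"
  shows "\<exists>u d. (\<forall>i\<in>S. \<forall>j\<in>S. cdot (u i) (u j) = (if i = j then 1 else 0)) \<and>
    (\<forall>j\<in>S. A *v u j = d j *\<^sub>R u j)"
  using finite[of S]
proof (induction S)
  case empty
  show ?case by simp
next
  case (insert k S)
  then obtain u d where on: "\<And>i j. i \<in> S \<Longrightarrow> j \<in> S \<Longrightarrow> cdot (u i) (u j) = (if i = j then 1 else 0)"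
    and eig: "\<And>j. j \<in> S \<Longrightarrow> A *v u j = d j *\<^sub>R u j" by blast
  have "S \<noteq> UNIV" using insert by auto
  then obtain v l where v: "v \<bullet> v = 1" "A *v v = l *\<^sub>R v" "\<And>j. j \<in> S \<Longrightarrow> cdot (u j) v = 0"
    using hermitian_eigenvector_in_complement[of A S u d] assms eig by metis
  then have "\<And>j. j \<in> S \<Longrightarrow> cdot v (u j) = 0" by (simp add: cdot_commute[of v])
  moreover have "cdot v v = 1" using v by (simp add: cdot_self)
  ultimately show ?case using on eig v insert(2)
    by (intro exI[of _ "u(k := v)"] exI[of _ "d(k := l)"]) auto
qed

lemma mult_real_diag_nth: "(W ** real_diag d) $ i $ j = W $ i $ j * of_real (d j)"
  by (simp add: matrix_matrix_mult_def real_diag_def if_distrib cong: if_cong)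

lemma real_diag_mult_nth: "(real_diag d ** W) $ i $ j = of_real (d i) * W $ i $ j"
  by (simp add: matrix_matrix_mult_def real_diag_def if_distrib[of "\<lambda>x. x * _"] cong: if_cong)

lemma real_diag_mult_vec_nth: "(real_diag d *v x) $ i = of_real (d i) * x $ i"
  by (simp add: matrix_vector_mult_def real_diag_def if_distrib[of "\<lambda>x. x * _"] cong: if_cong)

lemma real_diag_mult: "real_diag d ** real_diag e = real_diag (\<lambda>i. d i * e i)"
  by (simp add: vec_eq_iff mult_real_diag_nth) (simp add: real_diag_def)

lemma real_diag_1 [simp]: "real_diag (\<lambda>i. 1) = mat 1"
  by (simp add: vec_eq_iff real_diag_def mat_def)

lemma ctranspose_real_diag [simp]: "ctranspose (real_diag d) = real_diag d"
  by (auto simp: vec_eq_iff real_diag_def)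

lemma hermitian_spectral_decomposition:
  fixes A :: "complex^'n^'n"
  assumes "hermitian A"
  obtains U d where "unitary U" "A = U ** real_diag d ** ctranspose U"
proof -
  obtain u :: "'n \<Rightarrow> complex^'n" and d where on: "\<And>i j. cdot (u i) (u j) = (if i = j then 1 else 0)"
    and eig: "\<And>j. A *v u j = d j *\<^sub>R u j"
    using hermitian_orthonormal_eigenvectors[OF assms, of UNIV] by blast
  define U :: "complex^'n^'n" where "U = (\<chi> i j. u j $ i)"
  have "ctranspose U ** U = mat 1"
    using on by (simp add: vec_eq_iff U_def matrix_matrix_mult_def mat_def cdot_def)
  then have U: "unitary U" by (simp add: unitary_def matrix_left_right_inverse)
  have "A ** U = U ** real_diag d"
    using eig by (simp add: vec_eq_iff mult_real_diag_nth)
      (simp add: U_def matrix_matrix_mult_def matrix_vector_mult_def scaleR_conv_of_real mult.commute)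
  then have "A = U ** real_diag d ** ctranspose U"
    using U by (metis (no_types) matrix_mul_assoc matrix_mul_rid unitary_def)
  with U show ?thesis by (rule that)
qed

lemma posdef_spectral_decomposition:
  fixes A :: "complex^'n^'n"
  assumes "A \<in> posdef"
  obtains U d where "unitary U" "\<And>i. 0 < d i" "A = U ** real_diag d ** ctranspose U"
proof -
  obtain U d where U: "unitary U" and A: "A = U ** real_diag d ** ctranspose U"
    using hermitian_spectral_decomposition assms by (metis posdef_iff)
  have "ctranspose U ** A ** U = real_diag d"
    using U unfolding A unitary_def
    by (simp add: matrix_mul_cancel_left flip: matrix_mul_assoc)
  moreover have "ctranspose U ** A ** U \<in> posdef"
    using U assms by (intro posdef_congruence) (auto simp: unitary_def)
  ultimately have pd: "real_diag d \<in> posdef" by simp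
  have "0 < d i" for i
  proof -
    have "(axis i (1::complex)) \<bullet> (real_diag d *v axis i 1) = d i"
      by (simp add: inner_axis' real_diag_mult_vec_nth inner_complex_def)
    moreover have "axis i (1::complex) \<noteq> 0" by (simp add: axis_eq_0_iff)
    ultimately show ?thesis using pd by (metis posdef_iff)
  qed
  then show ?thesis using that U A by blast
qed

lemma posdef_real_diag:
  fixes d :: "'n::finite \<Rightarrow> real"
  assumes "\<And>i. 0 < d i"
  shows "real_diag d \<in> posdef"
proof -
  have "0 < x \<bullet> (real_diag d *v x)" if "x \<noteq> 0" for x :: "complex^'n"
  proof -
    have e: "x \<bullet> (real_diag d *v x) = (\<Sum>i\<in>UNIV. d i * (x $ i \<bullet> x $ i))"
      by (simp add: inner_vec_def real_diag_mult_vec_nth inner_complex_def algebra_simps)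
    obtain i where "x $ i \<noteq> 0" using \<open>x \<noteq> 0\<close> by (auto simp: vec_eq_iff)
    then show ?thesis unfolding e using assms
      by (intro sum_pos2[of _ i]) (auto intro!: mult_nonneg_nonneg simp: less_imp_le)
  qed
  then show ?thesis by (simp add: posdef_iff hermitian_def)
qed

section \<open>Powers of positive definite matrices\<close>

text \<open>Intertwining two diagonal matrices only constrains the support of \<open>W\<close>, and that condition
  survives applying one function to both spectra.\<close>

lemma intertwine_real_diag_iff:
  "W ** real_diag d = real_diag e ** W \<longleftrightarrow> (\<forall>i j. W $ i $ j \<noteq> 0 \<longrightarrow> e i = d j)"
  by (simp add: vec_eq_iff mult_real_diag_nth real_diag_mult_nth) metis

lemma intertwine_real_diag_map:
  assumes "W ** real_diag d = real_diag e ** W"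
  shows "W ** real_diag (\<lambda>i. f (d i)) = real_diag (\<lambda>i. f (e i)) ** W"
  using assms unfolding intertwine_real_diag_iff by auto

text \<open>Two diagonalisations of the same matrix are intertwined by the product of the unitaries,
  so they yield the same powers.\<close>

lemma mat_powr_spectral:
  assumes U: "unitary U" and d: "\<And>i. 0 < d i"
  shows "mat_powr (U ** real_diag d ** ctranspose U) t
    = U ** real_diag (\<lambda>i. d i powr t) ** ctranspose U"
  unfolding mat_powr_def
proof (rule the_equality)
  show "\<exists>V e. unitary V \<and> (\<forall>i. 0 < e i) \<and>
      U ** real_diag d ** ctranspose U = V ** real_diag e ** ctranspose V \<and>
      U ** real_diag (\<lambda>i. d i powr t) ** ctranspose U = V ** real_diag (\<lambda>i. e i powr t) ** ctranspose V"
    using U d by blast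
next
  fix B
  assume "\<exists>V e. unitary V \<and> (\<forall>i. 0 < e i) \<and>
      U ** real_diag d ** ctranspose U = V ** real_diag e ** ctranspose V \<and>
      B = V ** real_diag (\<lambda>i. e i powr t) ** ctranspose V"
  then obtain V e where V: "unitary V"
    and eq: "U ** real_diag d ** ctranspose U = V ** real_diag e ** ctranspose V"
    and B: "B = V ** real_diag (\<lambda>i. e i powr t) ** ctranspose V" by blast
  have UU: "ctranspose U ** U = mat 1" "U ** ctranspose U = mat 1"
    and VV: "ctranspose V ** V = mat 1" "V ** ctranspose V = mat 1"
    using U V by (auto simp: unitary_def)
  have "ctranspose V ** (U ** real_diag d ** ctranspose U) ** U
      = ctranspose V ** (V ** real_diag e ** ctranspose V) ** U" by (simp add: eq)
  then have "(ctranspose V ** U) ** real_diag d = real_diag e ** (ctranspose V ** U)"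
    using UU VV by (simp add: matrix_mul_cancel_left flip: matrix_mul_assoc)
  then have "(ctranspose V ** U) ** real_diag (\<lambda>i. d i powr t)
      = real_diag (\<lambda>i. e i powr t) ** (ctranspose V ** U)"
    by (rule intertwine_real_diag_map)
  then have "V ** ((ctranspose V ** U) ** real_diag (\<lambda>i. d i powr t)) ** ctranspose U
      = V ** (real_diag (\<lambda>i. e i powr t) ** (ctranspose V ** U)) ** ctranspose U" by simp
  then show "B = U ** real_diag (\<lambda>i. d i powr t) ** ctranspose U"
    unfolding B using UU VV by (simp add: matrix_mul_cancel_left flip: matrix_mul_assoc)
qed

text \<open>In the coordinates given by \<open>W = C\<^sup>1\<^sup>/\<^sup>2 U\<close>, where \<open>U\<close> diagonalises
  \<open>C\<^sup>-\<^sup>1\<^sup>/\<^sup>2 D C\<^sup>-\<^sup>1\<^sup>/\<^sup>2\<close>, both endpoints are diagonal, and the geodesic takes powers of the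
  diagonal entries.\<close>

lemma geodesic_simultaneous_diagonalisation:
  fixes C D :: "complex^'n^'n"
  assumes "C \<in> posdef" and "D \<in> posdef"
  obtains W W' :: "complex^'n^'n" and m where "W' ** W = mat 1" "\<And>i. 0 < m i"
    "C = W ** ctranspose W" "D = W ** real_diag m ** ctranspose W"
    "\<And>t. geodesic C D t = W ** real_diag (\<lambda>i. m i powr t) ** ctranspose W"
proof -
  obtain P c where P: "unitary P" and c: "\<And>i. 0 < c i"
    and C: "C = P ** real_diag c ** ctranspose P"
    using posdef_spectral_decomposition[OF assms(1)] by metis
  have PP: "ctranspose P ** P = mat 1" "P ** ctranspose P = mat 1" using P by (auto simp: unitary_def)
  define S where "S = mat_powr C (1/2)"
  define S' where "S' = mat_powr C (- (1/2))"
  have S: "S = P ** real_diag (\<lambda>i. c i powr (1/2)) ** ctranspose P"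
    and S': "S' = P ** real_diag (\<lambda>i. c i powr (- (1/2))) ** ctranspose P"
    unfolding S_def S'_def C by (rule mat_powr_spectral[OF P c])+
  have prod: "(P ** real_diag f ** ctranspose P) ** (P ** real_diag g ** ctranspose P)
      = P ** real_diag (\<lambda>i. f i * g i) ** ctranspose P" for f g
    by (simp add: PP matrix_mul_cancel_left flip: matrix_mul_assoc real_diag_mult)
  have "c i powr (1/2) * c i powr (1/2) = c i" "c i powr (1/2) * c i powr (- (1/2)) = 1" for i
    using c[of i] by (simp_all flip: powr_add)
  then have SS: "S ** S = C" and SS': "S ** S' = mat 1"
    unfolding S S' prod by (simp_all add: C PP)
  have S'S: "S' ** S = mat 1" using SS' by (simp add: matrix_left_right_inverse)
  have hS: "ctranspose S = S" and hS': "ctranspose S' = S'"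
    by (simp_all add: S S' ctranspose_mult matrix_mul_assoc)
  have "S' ** D ** S' \<in> posdef"
    using posdef_congruence[OF assms(2) SS'] by (simp add: hS')
  then obtain U m where U: "unitary U" and m: "\<And>i. 0 < m i"
    and M: "S' ** D ** S' = U ** real_diag m ** ctranspose U"
    using posdef_spectral_decomposition by metis
  have UU: "ctranspose U ** U = mat 1" "U ** ctranspose U = mat 1" using U by (auto simp: unitary_def)
  show ?thesis
  proof (rule that[of "ctranspose U ** S'" "S ** U" m])
    show "ctranspose U ** S' ** (S ** U) = mat 1"
      by (simp add: UU S'S matrix_mul_cancel_left flip: matrix_mul_assoc)
    show "C = S ** U ** ctranspose (S ** U)"
      by (simp add: UU SS hS ctranspose_mult matrix_mul_cancel_left flip: matrix_mul_assoc)
    have "D = S ** (S' ** D ** S') ** S"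
      by (simp add: SS' S'S matrix_mul_cancel_left flip: matrix_mul_assoc)
    then show "D = S ** U ** real_diag m ** ctranspose (S ** U)"
      by (simp add: M hS ctranspose_mult matrix_mul_assoc)
    show "geodesic C D t = S ** U ** real_diag (\<lambda>i. m i powr t) ** ctranspose (S ** U)" for t
      unfolding geodesic_def S_def[symmetric] S'_def[symmetric] M
      by (simp add: mat_powr_spectral[OF U m] hS ctranspose_mult matrix_mul_assoc)
  qed (rule m)
qed

section \<open>Rigidity of a two-cycle\<close>

text \<open>A discrete maximum principle in energy form: multiplying the hypothesis by \<open>m j\<close> and summing
  shows that the Dirichlet energy of a harmonic function \<open>m\<close> on a finite weighted graph is zero.\<close>

lemma harmonic_imp_locally_constant:
  fixes p :: "'a::finite \<Rightarrow> 'a \<Rightarrow> real" and m :: "'a \<Rightarrow> real"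
  assumes sym: "\<And>j k. p j k = p k j" and nonneg: "\<And>j k. 0 \<le> p j k"
    and harm: "\<And>j. (\<Sum>k\<in>UNIV. p j k) * m j = (\<Sum>k\<in>UNIV. p j k * m k)"
    and "p j k \<noteq> 0"
  shows "m j = m k"
proof -
  have "(\<Sum>j\<in>UNIV. \<Sum>k\<in>UNIV. p j k * m j * (m j - m k))
      = (\<Sum>j\<in>UNIV. m j * ((\<Sum>k\<in>UNIV. p j k) * m j - (\<Sum>k\<in>UNIV. p j k * m k)))"
    by (simp add: sum_distrib_left sum_distrib_right right_diff_distrib sum_subtractf mult_ac)
  then have E: "(\<Sum>j\<in>UNIV. \<Sum>k\<in>UNIV. p j k * m j * (m j - m k)) = 0" by (simp add: harm)
  then have E': "(\<Sum>j\<in>UNIV. \<Sum>k\<in>UNIV. p j k * m k * (m k - m j)) = 0"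
    by (subst sum.swap) (simp add: sym)
  have "p j k * (m j - m k)\<^sup>2 = p j k * m j * (m j - m k) + p j k * m k * (m k - m j)" for j k
    by (simp add: power2_eq_square algebra_simps)
  then have "(\<Sum>j\<in>UNIV. \<Sum>k\<in>UNIV. p j k * (m j - m k)\<^sup>2) = 0"
    using E E' by (simp add: sum.distrib)
  then have "p j k * (m j - m k)\<^sup>2 = 0"
    by (simp add: sum_nonneg_eq_0_iff sum_nonneg nonneg)
  then show ?thesis using assms(4) by simp
qed

text \<open>The two hypotheses on sums say that \<open>X \<mapsto> (\<Sum>i\<in>I. B i ** X ** B i)\<close> followed by inversion
  exchanges \<open>1\<close> and \<open>diag(m)\<close>. Their diagonals make \<open>m\<close> harmonic for the weights \<open>p j k\<close>, which are symmetric
  because the \<open>B i\<close> are Hermitian. Hence every \<open>B i\<close> only links indices with equal \<open>m\<close>.\<close>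

lemma two_cycle_imp_commute:
  fixes B :: "'i \<Rightarrow> complex^'n^'n"
  assumes "finite I" and herm: "\<And>i. i \<in> I \<Longrightarrow> hermitian (B i)"
    and N0: "(\<Sum>i\<in>I. B i ** B i) ** real_diag m = mat 1"
    and N1: "(\<Sum>i\<in>I. B i ** real_diag m ** B i) = mat 1"
    and "i \<in> I"
  shows "B i ** real_diag m = real_diag m ** B i"
proof -
  define p where "p j k = (\<Sum>i\<in>I. (cmod (B i $ j $ k))\<^sup>2)" for j k
  have sym: "p j k = p k j" for j k
    unfolding p_def by (rule sum.cong) (use herm in \<open>auto simp: hermitian_nth[symmetric, of _ j k]\<close>)
  have entry: "B i $ j $ k * B i $ k $ j = of_real ((cmod (B i $ j $ k))\<^sup>2)" if "i \<in> I" for i j k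
    by (metis herm[OF that] hermitian_nth complex_norm_square)
  have diag: "(\<Sum>i\<in>I. B i ** real_diag f ** B i) $ j $ j = of_real (\<Sum>k\<in>UNIV. p j k * f k)" for f j
  proof -
    have "(\<Sum>i\<in>I. B i ** real_diag f ** B i) $ j $ j
        = (\<Sum>i\<in>I. \<Sum>k\<in>UNIV. B i $ j $ k * of_real (f k) * B i $ k $ j)"
      by (simp add: matrix_matrix_mult_def[of "_ ** _"] mult_real_diag_nth)
    also have "\<dots> = (\<Sum>i\<in>I. \<Sum>k\<in>UNIV. of_real ((cmod (B i $ j $ k))\<^sup>2 * f k))"
      by (intro sum.cong refl) (simp add: entry[symmetric] mult_ac del: of_real_power)
    also have "\<dots> = of_real (\<Sum>k\<in>UNIV. p j k * f k)"
      unfolding p_def sum_distrib_right of_real_sum by (rule sum.swap)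
    finally show ?thesis .
  qed
  have "(\<Sum>k\<in>UNIV. p j k) * m j = (\<Sum>k\<in>UNIV. p j k * m k)" for j
  proof -
    have "complex_of_real ((\<Sum>k\<in>UNIV. p j k) * m j) = ((\<Sum>i\<in>I. B i ** B i) ** real_diag m) $ j $ j"
      using diag[of "\<lambda>_. 1" j] by (simp add: mult_real_diag_nth)
    also have "\<dots> = complex_of_real (\<Sum>k\<in>UNIV. p j k * m k)"
      using diag[of m j] by (simp add: N0 N1)
    finally show ?thesis unfolding of_real_eq_iff .
  qed
  then have "m j = m k" if "p j k \<noteq> 0" for j k
    using that sym by (intro harmonic_imp_locally_constant[of p]) (auto simp: p_def sum_nonneg)
  moreover have "p j k \<noteq> 0" if "B i $ j $ k \<noteq> 0" for j k
    using that \<open>i \<in> I\<close> \<open>finite I\<close> by (auto simp: p_def sum_nonneg_eq_0_iff)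
  ultimately show ?thesis by (auto simp: intertwine_real_diag_iff)
qed

lemma inverse_map_eq_Some_iff:
  "inverse_map \<eta> X = Some Y \<longleftrightarrow> X \<in> posdef \<and> \<eta> X ** Y = mat 1"
proof -
  have "\<eta> X ** Y = mat 1 \<Longrightarrow> invertible (\<eta> X)"
    by (metis invertible_def matrix_left_right_inverse)
  moreover have "invertible (\<eta> X) \<Longrightarrow> \<eta> X ** matrix_inv (\<eta> X) = mat 1"
    using matrix_inv_eqI by (metis invertible_def)
  ultimately show ?thesis by (auto simp: inverse_map_def dest: matrix_inv_eqI)
qed

theorem proposition3p12:
  fixes A :: "nat \<Rightarrow> complex ^ 'n ^ 'n"
    and \<eta> :: "complex ^ 'n ^ 'n \<Rightarrow> complex ^ 'n ^ 'n"
    and C D :: "complex ^ 'n ^ 'n"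
    and r :: nat
  assumes "\<And>i. i \<in> {1..r} \<Longrightarrow> hermitian (A i)"
    and "\<And>X. \<eta> X = (\<Sum>i = 1..r. A i ** X ** A i)"
    and "C \<in> posdef" and "D \<in> posdef"
    and "two_cycle (inverse_map \<eta>) C D"
  shows "\<forall>t::real. inverse_map \<eta> (geodesic C D t) = Some (geodesic C D (1 - t))"
proof
  fix t :: real
  obtain W W' :: "complex^'n^'n" and m where W'W: "W' ** W = mat 1" and m: "\<And>i. 0 < m i"
    and C: "C = W ** ctranspose W" and D: "D = W ** real_diag m ** ctranspose W"
    and geo: "\<And>t. geodesic C D t = W ** real_diag (\<lambda>i. m i powr t) ** ctranspose W"
    using geodesic_simultaneous_diagonalisation[OF assms(3,4)] by metis
  have WW': "W ** W' = mat 1" using W'W by (simp add: matrix_left_right_inverse)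
  have tW: "ctranspose W ** ctranspose W' = mat 1" "ctranspose W' ** ctranspose W = mat 1"
    using W'W WW' by (simp_all flip: ctranspose_mult)
  define B where "B i = ctranspose W ** A i ** W" for i
  have herm: "hermitian (B i)" if "i \<in> {1..r}" for i
    unfolding B_def using assms(1)[OF that] by (rule hermitian_congruence)
  have \<eta>: "ctranspose W ** \<eta> (W ** X ** ctranspose W) ** W = (\<Sum>i = 1..r. B i ** X ** B i)" for X
    by (simp add: assms(2) sum_matrix_mult_left sum_matrix_mult_right B_def matrix_mul_assoc)
  have cancel: "X ** Y = mat 1 \<longleftrightarrow>
      (ctranspose W ** X ** W) ** (W' ** Y ** ctranspose W') = mat 1" for X Y
  proof -
    have "(ctranspose W ** X ** W) ** (W' ** Y ** ctranspose W')
        = ctranspose W ** (X ** Y) ** ctranspose W'"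
      by (simp add: WW' matrix_mul_cancel_left flip: matrix_mul_assoc)
    moreover have "ctranspose W ** Z ** ctranspose W' = mat 1 \<longleftrightarrow> Z = mat 1" for Z
    proof
      assume "ctranspose W ** Z ** ctranspose W' = mat 1"
      then have "ctranspose W' ** (ctranspose W ** Z ** ctranspose W') ** ctranspose W = mat 1"
        by (simp add: tW)
      then show "Z = mat 1" by (simp add: tW matrix_mul_cancel_left flip: matrix_mul_assoc)
    qed (simp add: tW)
    ultimately show ?thesis by simp
  qed
  have coords: "W' ** (W ** X ** ctranspose W) ** ctranspose W' = X" for X
    by (simp add: tW W'W matrix_mul_cancel_left flip: matrix_mul_assoc)
  have "\<eta> C ** D = mat 1" "\<eta> D ** C = mat 1"
    using assms(5) by (auto simp: two_cycle_def inverse_map_eq_Some_iff)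
  moreover have C': "C = W ** mat 1 ** ctranspose W" by (simp add: C)
  ultimately have N0: "(\<Sum>i = 1..r. B i ** B i) ** real_diag m = mat 1"
    and N1: "(\<Sum>i = 1..r. B i ** real_diag m ** B i) = mat 1"
    using cancel[of "\<eta> C" D] cancel[of "\<eta> D" C] unfolding C' D \<eta> coords by simp_all
  have comm: "B i ** real_diag (\<lambda>j. m j powr t) = real_diag (\<lambda>j. m j powr t) ** B i"
    if "i \<in> {1..r}" for i
    by (rule intertwine_real_diag_map, rule two_cycle_imp_commute[OF _ herm N0 N1 that]) simp
  have "(\<Sum>i = 1..r. B i ** real_diag (\<lambda>j. m j powr t) ** B i)
      = real_diag (\<lambda>j. m j powr t) ** (\<Sum>i = 1..r. B i ** B i)"
    unfolding sum_matrix_mult_left by (rule sum.cong) (simp_all only: comm matrix_mul_assoc)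
  \<comment> \<open>Splitting off the factor \<open>diag(m)\<close> from \<open>diag(m powr (1 - t))\<close> lets it cancel against
    \<open>\<Sum>i. B i ** B i\<close>.\<close>
  moreover have "real_diag (\<lambda>j. m j powr (1 - t)) = real_diag m ** real_diag (\<lambda>j. m j powr (- t))"
    using m by (simp add: real_diag_mult powr_diff powr_minus_divide less_imp_le)
  moreover have "real_diag (\<lambda>j. m j powr t) ** real_diag (\<lambda>j. m j powr (- t)) = mat 1"
    using m by (simp add: real_diag_mult less_imp_neq[symmetric] flip: powr_add)
  ultimately have "(\<Sum>i = 1..r. B i ** real_diag (\<lambda>j. m j powr t) ** B i)
      ** real_diag (\<lambda>j. m j powr (1 - t)) = mat 1"
    by (simp add: matrix_mul_cancel_left[OF N0] del: One_nat_def flip: matrix_mul_assoc)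
  then have "\<eta> (geodesic C D t) ** geodesic C D (1 - t) = mat 1"
    unfolding cancel[of "\<eta> (geodesic C D t)"] unfolding geo \<eta> coords .
  moreover have "geodesic C D t \<in> posdef"
    using posdef_congruence[of "real_diag (\<lambda>j. m j powr t)" "ctranspose W'" "ctranspose W"]
      posdef_real_diag[of "\<lambda>j. m j powr t"] m tW
    by (simp add: geo less_imp_neq[symmetric])
  ultimately show "inverse_map \<eta> (geodesic C D t) = Some (geodesic C D (1 - t))"
    by (simp add: inverse_map_eq_Some_iff)
qed

end
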